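(* Let $n \ge 1$ and let $P$ be a non-trivial product distribution on $\{0,1\}^n$. Then for every antichain $A \subset \{0,1\}^n$, $$\Pr_{z \sim P}[ z \in A] \leq \max_{\ell \in \{0,1,\ldots,n\}} \Pr_{z \sim P}[|z|=\ell].$$
   Context: Elements of $\{0,1\}^n$ are identified with subsets of $[n]=\{1,\ldots,n\}$, and $|z|$ denotes the number of coordinates of $z$ equal to $1$. An antichain is a family $A \subset \{0,1\}^n$ containing no two sets with one strictly contained in the other. A product distribution $P$ on $\{0,1\}^n$ is one under which the coordinates $z_1,\ldots,z_n$ are independent; write $p_j = \Pr_{z \sim P}[z_j = 1]$. $P$ is called non-trivial if $p_j(1-p_j) > 0$ for all $j \in [n]$. *)

theory Defs
  imports "HOL-Probability.Probability"
begin

(* A point z of {0,1}^n is the subset of {1..n} of coordinates equal to 1,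
   so the j-th coordinate is the random variable "j \<in> z" and |z| is "card z". *)

definition antichain_family :: "nat \<Rightarrow> nat set set \<Rightarrow> bool" where
  "antichain_family n A \<longleftrightarrow> A \<subseteq> Pow {1..n} \<and> (\<forall>x\<in>A. \<forall>y\<in>A. \<not> x \<subset> y)"

definition product_distribution :: "nat \<Rightarrow> nat set pmf \<Rightarrow> bool" where
  "product_distribution n P \<longleftrightarrow>
     set_pmf P \<subseteq> Pow {1..n} \<and>
     prob_space.indep_vars (measure_pmf P) (\<lambda>_. count_space UNIV) (\<lambda>j z. j \<in> z) {1..n}"

definition marginal :: "nat set pmf \<Rightarrow> nat \<Rightarrow> real" where
  "marginal P j = measure_pmf.prob P {z. j \<in> z}"

definition nontrivial_distribution :: "nat \<Rightarrow> nat set pmf \<Rightarrow> bool" where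
  "nontrivial_distribution n P \<longleftrightarrow> (\<forall>j\<in>{1..n}. marginal P j * (1 - marginal P j) > 0)"

end

(* Write m_k for P conditioned on |z| = k. The argument is a weighted LYM inequality: the sum over k
   of m_k(A) is at most 1. The key point is that m_k is stochastically increasing in k, i.e. the
   m_k-expectation of a monotone function increases with k. This follows by induction on the number
   of coordinates: conditionally on the last coordinate, the rest of z has the corresponding law
   in one dimension less, and the probability that the last coordinate is 1 increases with k because
   the law of |z| is log-concave. Given an antichain A, let V_k be the up-set generated by the
   members of A of size at most k. On the level k + 1 the set V_(k+1) is the disjoint union of V_k
   and A, so m_(k+1)(V_(k+1)) is at least m_k(V_k) + m_(k+1)(A), and m_n(V_n) bounds the sum. *)

theory Submission
  imports Defs
begin

section \<open>Product weights on the levels of the Boolean lattice\<close>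

definition level :: "'a set \<Rightarrow> nat \<Rightarrow> 'a set set" where
  "level X k = {S. S \<subseteq> X \<and> card S = k}"

text \<open>With \<open>q j = 1 - p j\<close> this is the point mass of a product distribution. A
  free \<open>q\<close> lets the inductions rely on positivity of both weights alone, with no
  normalisation to carry along.\<close>

definition prod_weight :: "('a \<Rightarrow> real) \<Rightarrow> ('a \<Rightarrow> real) \<Rightarrow> 'a set \<Rightarrow> 'a set \<Rightarrow> real" where
  "prod_weight p q X S = (\<Prod>j\<in>S. p j) * (\<Prod>j\<in>X - S. q j)"

text \<open>An unnormalised expectation: dividing by the value at \<open>f = (\<lambda>_. 1)\<close>
  gives the mean of \<open>f\<close> conditioned on level \<open>k\<close>. For finite
  \<open>X\<close> that value is the coefficient of \<open>t^k\<close> in the product of the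
  polynomials \<open>q j + p j * t\<close>.\<close>

definition level_sum ::
    "('a \<Rightarrow> real) \<Rightarrow> ('a \<Rightarrow> real) \<Rightarrow> 'a set \<Rightarrow> nat \<Rightarrow> ('a set \<Rightarrow> real) \<Rightarrow> real" where
  "level_sum p q X k f = (\<Sum>S\<in>level X k. prod_weight p q X S * f S)"

lemma finite_level: "finite X \<Longrightarrow> finite (level X k)"
  by (rule finite_subset[of _ "Pow X"]) (auto simp: level_def)

lemma level_0: "finite X \<Longrightarrow> level X 0 = {{}}"
  by (auto simp: level_def dest: finite_subset)

lemma level_eq_empty: "finite X \<Longrightarrow> card X < k \<Longrightarrow> level X k = {}"
  by (auto simp: level_def dest: card_mono)

section \<open>Recursion in the number of coordinates\<close>

lemma level_insert_Suc:
  assumes "finite X" "x \<notin> X"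
  shows "level (insert x X) (Suc k) = level X (Suc k) \<union> insert x ` level X k"
proof (intro equalityI subsetI)
  fix S assume S: "S \<in> level (insert x X) (Suc k)"
  then have "finite S"
    using assms by (auto simp: level_def intro: finite_subset)
  show "S \<in> level X (Suc k) \<union> insert x ` level X k"
  proof (cases "x \<in> S")
    case True
    then have "S = insert x (S - {x})" "S - {x} \<in> level X k"
      using S \<open>finite S\<close> by (auto simp: level_def)
    then show ?thesis by blast
  next
    case False
    then show ?thesis using S by (auto simp: level_def)
  qed
next
  fix S assume "S \<in> level X (Suc k) \<union> insert x ` level X k"
  then show "S \<in> level (insert x X) (Suc k)"
  proof
    assume "S \<in> insert x ` level X k"
    then obtain T where "S = insert x T" "T \<subseteq> X" "card T = k"
      by (auto simp: level_def)
    moreover have "finite T" "x \<notin> T"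
      using calculation assms by (auto intro: finite_subset)
    ultimately show ?thesis by (auto simp: level_def)
  qed (auto simp: level_def)
qed

lemma prod_weight_insert_out:
  assumes "finite X" "x \<notin> X" "S \<subseteq> X"
  shows "prod_weight p q (insert x X) S = q x * prod_weight p q X S"
proof -
  have "insert x X - S = insert x (X - S)"
    using assms by auto
  then show ?thesis
    using assms by (simp add: prod_weight_def)
qed

lemma prod_weight_insert_in:
  assumes "finite X" "x \<notin> X" "S \<subseteq> X"
  shows "prod_weight p q (insert x X) (insert x S) = p x * prod_weight p q X S"
proof -
  have "insert x X - insert x S = X - S" "x \<notin> S" "finite S"
    using assms by (auto intro: finite_subset)
  then show ?thesis
    by (simp add: prod_weight_def)
qed

lemma level_sum_insert_0:
  assumes "finite X" "x \<notin> X"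
  shows "level_sum p q (insert x X) 0 f = q x * level_sum p q X 0 f"
  using assms by (simp add: level_sum_def level_0 prod_weight_insert_out)

text \<open>Sets are split by whether they contain \<open>x\<close>. For
  \<open>f = (\<lambda>_. 1)\<close> this is multiplication of the generating polynomial by
  \<open>q x + p x * t\<close>.\<close>

lemma level_sum_insert_Suc:
  assumes "finite X" "x \<notin> X"
  shows "level_sum p q (insert x X) (Suc k) f =
    q x * level_sum p q X (Suc k) f + p x * level_sum p q X k (\<lambda>S. f (insert x S))"
proof -
  let ?w = "prod_weight p q (insert x X)"
  have inj: "inj_on (insert x) (level X k)"
    using assms by (auto simp: inj_on_def level_def)
  have "level_sum p q (insert x X) (Suc k) f =
      (\<Sum>S\<in>level X (Suc k). ?w S * f S) + (\<Sum>S\<in>insert x ` level X k. ?w S * f S)"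
    unfolding level_sum_def level_insert_Suc[OF assms]
    using assms by (intro sum.union_disjoint) (auto simp: finite_level, auto simp: level_def)
  also have "(\<Sum>S\<in>level X (Suc k). ?w S * f S) = q x * level_sum p q X (Suc k) f"
    unfolding level_sum_def sum_distrib_left using assms
    by (intro sum.cong) (auto simp: level_def prod_weight_insert_out)
  also have "(\<Sum>S\<in>insert x ` level X k. ?w S * f S) =
      (\<Sum>S\<in>level X k. ?w (insert x S) * f (insert x S))"
    by (simp add: sum.reindex[OF inj])
  also have "\<dots> = p x * level_sum p q X k (\<lambda>S. f (insert x S))"
    unfolding level_sum_def sum_distrib_left using assms
    by (intro sum.cong) (auto simp: level_def prod_weight_insert_in)
  finally show ?thesis .
qed

section \<open>Vanishing, linearity, monotonicity and positivity of level sums\<close>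

lemma level_sum_eq_0: "finite X \<Longrightarrow> card X < k \<Longrightarrow> level_sum p q X k f = 0"
  by (simp add: level_sum_def level_eq_empty)

lemma level_sum_add:
  "level_sum p q X k (\<lambda>S. f S + g S) = level_sum p q X k f + level_sum p q X k g"
  by (simp add: level_sum_def sum.distrib distrib_left)

lemma prod_weight_pos:
  assumes "\<And>j. j \<in> X \<Longrightarrow> p j > 0" "\<And>j. j \<in> X \<Longrightarrow> q j > 0" "S \<subseteq> X"
  shows "prod_weight p q X S > 0"
  unfolding prod_weight_def using assms by (intro mult_pos_pos prod_pos) auto

lemma level_sum_mono:
  assumes "\<And>j. j \<in> X \<Longrightarrow> p j > 0" "\<And>j. j \<in> X \<Longrightarrow> q j > 0"
    and "\<And>S. S \<in> level X k \<Longrightarrow> f S \<le> g S"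
  shows "level_sum p q X k f \<le> level_sum p q X k g"
  unfolding level_sum_def using assms
  by (intro sum_mono mult_left_mono less_imp_le[OF prod_weight_pos]) (auto simp: level_def)

lemma level_sum_pos:
  assumes "finite X" "\<And>j. j \<in> X \<Longrightarrow> p j > 0" "\<And>j. j \<in> X \<Longrightarrow> q j > 0" "k \<le> card X"
  shows "level_sum p q X k (\<lambda>_. 1) > 0"
proof -
  obtain S where "S \<subseteq> X" "card S = k"
    using obtain_subset_with_card_n[OF \<open>k \<le> card X\<close>] by metis
  then have "level X k \<noteq> {}"
    by (auto simp: level_def)
  then show ?thesis
    unfolding level_sum_def using assms
    by (intro sum_pos finite_level) (auto simp: level_def intro!: prod_weight_pos)
qed

section \<open>Log-concavity\<close>

(* Stated for all pairs i \<le> j rather than for neighbours only, so that the induction needs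
   no division. *)
lemma level_sum_log_concave:
  assumes "finite X" "\<And>j. j \<in> X \<Longrightarrow> p j > 0" "\<And>j. j \<in> X \<Longrightarrow> q j > 0" "i \<le> j"
  shows "level_sum p q X i (\<lambda>_. 1) * level_sum p q X (Suc j) (\<lambda>_. 1)
       \<le> level_sum p q X (Suc i) (\<lambda>_. 1) * level_sum p q X j (\<lambda>_. 1)"
  using assms
proof (induction X arbitrary: i j rule: finite_induct)
  case empty
  then show ?case
    by (simp add: level_sum_eq_0)
next
  case (insert x X)
  define a where "a k = level_sum p q X k (\<lambda>_. 1)" for k
  have pq: "p x > 0" "q x > 0"
    using insert.prems by auto
  have a0: "a k \<ge> 0" for k
    using level_sum_pos[of X p q k] level_sum_eq_0[of X k p q] insert
    by (cases "k \<le> card X") (auto simp: a_def less_imp_le)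
  have IH: "a i * a (Suc j) \<le> a (Suc i) * a j" if "i \<le> j" for i j
    unfolding a_def using insert that by blast
  show ?case
  \<comment> \<open>The diagonal case is an equality. Setting it aside gives
    \<open>i \<le> j - 1\<close>, which the mixed term below relies on.\<close>
  proof (cases "i = j")
    case True
    then show ?thesis by (simp add: mult.commute)
  next
    case False
    then obtain m where j: "j = Suc m" "i \<le> m"
      using \<open>i \<le> j\<close> by (cases j) auto
    show ?thesis
    proof (cases i)
      case 0
      \<comment> \<open>After the recursion both sides are quadratic forms in \<open>q x\<close> and
        \<open>p x\<close>; the three facts compare them coefficient by coefficient.\<close>
      have "q x * q x * (a 0 * a (Suc j)) \<le> q x * q x * (a 1 * a j)"
        using IH[of 0 j] pq by (intro mult_left_mono) auto
      moreover have "q x * p x * (a 0 * a j) \<le> q x * p x * (a 0 * a j + a 1 * a m)"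
        using a0 pq by (intro mult_left_mono) auto
      moreover have "0 \<le> p x * p x * (a 0 * a m)"
        using a0 pq by simp
      ultimately show ?thesis
        using insert.hyps unfolding 0 j(1)
        by (simp add: level_sum_insert_0 level_sum_insert_Suc flip: a_def)
          (simp add: algebra_simps j(1))
    next
      case (Suc l)
      have "q x * q x * (a i * a (Suc j)) \<le> q x * q x * (a (Suc i) * a j)"
        using IH[of i j] pq j by (intro mult_left_mono) auto
      moreover have "p x * p x * (a l * a j) \<le> p x * p x * (a i * a m)"
        using IH[of l m] pq j Suc by (intro mult_left_mono) auto
      \<comment> \<open>Mixed coefficient: the summand \<open>a i * a j\<close> is common to both
        sides, and the remaining products are compared by passing through \<open>a i * a j\<close>
        once more.\<close>
      moreover have "a l * a (Suc j) \<le> a (Suc i) * a m"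
        using IH[of l j] IH[of i m] j Suc by auto
      then have "q x * p x * (a l * a (Suc j)) \<le> q x * p x * (a (Suc i) * a m)"
        using pq by (intro mult_left_mono) auto
      ultimately show ?thesis
        using insert.hyps unfolding Suc j(1)
        by (simp add: level_sum_insert_Suc flip: a_def) (simp add: algebra_simps j(1) Suc)
    qed
  qed
qed

section \<open>Stochastic monotonicity of the levels\<close>

text \<open>Cross-multiplication keeps the claim meaningful for every \<open>k\<close>: from
  \<open>k = card X\<close> on, both sides vanish. In the induction \<open>F\<close> collects the
  sets without \<open>x\<close> and \<open>G\<close> those with \<open>x\<close>, and monotonicity
  of \<open>f\<close> enters as \<open>F k \<le> G k\<close>.\<close>

lemma level_mean_mono:
  fixes f :: "'a set \<Rightarrow> real"
  assumes "finite X" "\<And>j. j \<in> X \<Longrightarrow> p j > 0" "\<And>j. j \<in> X \<Longrightarrow> q j > 0" "mono f"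
  shows "level_sum p q X k f * level_sum p q X (Suc k) (\<lambda>_. 1)
       \<le> level_sum p q X (Suc k) f * level_sum p q X k (\<lambda>_. 1)"
  using assms
proof (induction X arbitrary: k f rule: finite_induct)
  case empty
  then show ?case
    by (simp add: level_sum_eq_0)
next
  case (insert x X)
  define a where "a k = level_sum p q X k (\<lambda>_. 1)" for k
  define F where "F k = level_sum p q X k f" for k
  define G where "G k = level_sum p q X k (\<lambda>S. f (insert x S))" for k
  have pq: "p x > 0" "q x > 0"
    using insert.prems by auto
  have mono_ins: "mono (\<lambda>S. f (insert x S))"
    by (intro monoI monoD[OF \<open>mono f\<close>]) auto
  have F: "F k * a (Suc k) \<le> F (Suc k) * a k" for k
    unfolding a_def F_def using insert by blast
  have G: "G k * a (Suc k) \<le> G (Suc k) * a k" for k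
    unfolding a_def G_def using insert mono_ins by blast
  have FG: "F k \<le> G k" for k
    unfolding F_def G_def using insert.prems
    by (intro level_sum_mono monoD[OF \<open>mono f\<close>]) auto
  have a_pos: "a k > 0" if "k \<le> card X" for k
    unfolding a_def using insert that by (intro level_sum_pos) auto
  have a_0: "a k = 0" "F k = 0" "G k = 0" if "k > card X" for k
    unfolding a_def F_def G_def using insert that by (auto simp: level_sum_eq_0)
  have a_nonneg: "a k \<ge> 0" for k
    using a_pos[of k] a_0[of k] by (cases "k \<le> card X") auto
  show ?case
  proof (cases k)
    case 0
    have "q x * q x * (F 0 * a 1) \<le> q x * q x * (F 1 * a 0)"
      using F[of 0] pq by (intro mult_left_mono) auto
    moreover have "q x * p x * (F 0 * a 0) \<le> q x * p x * (G 0 * a 0)"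
      using FG a_nonneg pq by (intro mult_left_mono mult_right_mono) auto
    ultimately show ?thesis
      using insert.hyps unfolding 0
      by (simp add: level_sum_insert_0 level_sum_insert_Suc flip: a_def F_def G_def)
        (simp add: algebra_simps)
  next
    case (Suc l)
    \<comment> \<open>The coefficient of \<open>q x * p x\<close>, the only one that does not follow
      from the induction hypotheses for \<open>F\<close> and \<open>G\<close> separately.\<close>
    have cross: "F (Suc l) * a (Suc l) + G l * a (Suc (Suc l))
        \<le> F (Suc (Suc l)) * a l + G (Suc l) * a (Suc l)"
    proof (cases "Suc l \<le> card X")
      case True
      \<comment> \<open>The claim is proved after multiplication by \<open>a (Suc l)\<close>. Moving
        \<open>F\<close> and \<open>G\<close> one level up leaves a multiple of
        \<open>a l * a (Suc (Suc l))\<close> by \<open>G (Suc l) - F (Suc l)\<close>, and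
        log-concavity bounds it because this difference is nonnegative.\<close>
      have "a l * a (Suc (Suc l)) \<le> a (Suc l) * a (Suc l)"
        unfolding a_def using insert by (intro level_sum_log_concave) auto
      then have "(G (Suc l) - F (Suc l)) * (a l * a (Suc (Suc l)))
          \<le> (G (Suc l) - F (Suc l)) * (a (Suc l) * a (Suc l))"
        using FG by (intro mult_left_mono) auto
      moreover have "G l * a (Suc l) * a (Suc (Suc l)) \<le> G (Suc l) * a l * a (Suc (Suc l))"
        using G a_nonneg by (intro mult_right_mono) auto
      moreover have "F (Suc l) * a (Suc (Suc l)) * a l \<le> F (Suc (Suc l)) * a (Suc l) * a l"
        using F a_nonneg by (intro mult_right_mono) auto
      ultimately have "(F (Suc l) * a (Suc l) + G l * a (Suc (Suc l))) * a (Suc l)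
          \<le> (F (Suc (Suc l)) * a l + G (Suc l) * a (Suc l)) * a (Suc l)"
        by (simp add: algebra_simps)
      then show ?thesis
        using a_pos[OF True] by simp
    next
      case False
      then show ?thesis
        by (simp add: a_0)
    qed
    have "q x * q x * (F (Suc l) * a (Suc (Suc l))) \<le> q x * q x * (F (Suc (Suc l)) * a (Suc l))"
      using F pq by (intro mult_left_mono) auto
    moreover have "p x * p x * (G l * a (Suc l)) \<le> p x * p x * (G (Suc l) * a l)"
      using G pq by (intro mult_left_mono) auto
    moreover have "q x * p x * (F (Suc l) * a (Suc l) + G l * a (Suc (Suc l)))
        \<le> q x * p x * (F (Suc (Suc l)) * a l + G (Suc l) * a (Suc l))"
      using cross pq by (intro mult_left_mono) auto
    ultimately show ?thesis
      using insert.hyps unfolding Suc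
      by (simp add: level_sum_insert_Suc flip: a_def F_def G_def) (simp add: algebra_simps)
  qed
qed

section \<open>The weighted LYM inequality\<close>

text \<open>For constant \<open>p\<close> and \<open>q\<close> all sets of a level have equal
  weight, each quotient is the proportion of that level lying in \<open>A\<close>, and the classical
  LYM inequality results.\<close>

lemma weighted_LYM:
  assumes X: "finite X" "\<And>j. j \<in> X \<Longrightarrow> p j > 0" "\<And>j. j \<in> X \<Longrightarrow> q j > 0"
    and antichain: "\<And>R S. R \<in> A \<Longrightarrow> S \<in> A \<Longrightarrow> \<not> R \<subset> S"
  shows "(\<Sum>k\<le>card X. level_sum p q X k (indicator A) / level_sum p q X k (\<lambda>_. 1)) \<le> 1"
proof -
  define a where "a k = level_sum p q X k (\<lambda>_. 1)" for k
  \<comment> \<open>Supersets reaching outside \<open>X\<close> are kept, so that the indicator of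
    \<open>V k\<close> is monotone on all sets, as \<open>level_mean_mono\<close> demands.\<close>
  define V where "V k = {S. \<exists>R\<in>A. card R \<le> k \<and> R \<subseteq> S}" for k
  have a_pos: "a k > 0" if "k \<le> card X" for k
    unfolding a_def using X that by (intro level_sum_pos) auto
  have "(\<Sum>i\<le>k. level_sum p q X i (indicator A) / a i) \<le> level_sum p q X k (indicator (V k)) / a k"
    if "k \<le> card X" for k
    using that
  proof (induction k)
    case 0
    have "level_sum p q X 0 (indicator A) \<le> level_sum p q X 0 (indicator (V 0))"
      using X by (intro level_sum_mono) (auto simp: level_0 V_def indicator_def)
    then show ?case
      using a_pos[of 0] by (simp add: divide_right_mono)
  next
    case (Suc k)
    have "mono (indicator (V k) :: _ \<Rightarrow> real)"
      by (rule monoI) (auto simp: V_def indicator_def)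
    then have "level_sum p q X k (indicator (V k)) * a (Suc k)
        \<le> level_sum p q X (Suc k) (indicator (V k)) * a k"
      unfolding a_def using X by (intro level_mean_mono) auto
    then have up: "level_sum p q X k (indicator (V k)) / a k
        \<le> level_sum p q X (Suc k) (indicator (V k)) / a (Suc k)"
      using a_pos[of k] a_pos[of "Suc k"] Suc.prems by (simp add: field_simps)
    have disj: "indicator (V k) S + indicator A S \<le> (indicator (V (Suc k)) S :: real)"
      if "S \<in> level X (Suc k)" for S
    proof (cases "S \<in> A")
      case True
      \<comment> \<open>A generator of \<open>V k\<close> inside \<open>S\<close> is smaller than
        \<open>S\<close>, hence a proper subset, which the antichain excludes.\<close>
      have "R \<noteq> S" if "card R \<le> k" for R
        using \<open>S \<in> level X (Suc k)\<close> that by (auto simp: level_def)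
      then have "S \<notin> V k"
        using True antichain[of _ S] by (auto simp: V_def psubset_eq)
      moreover have "S \<in> V (Suc k)"
        using True that by (auto simp: V_def level_def intro!: bexI[of _ S])
      ultimately show ?thesis by (simp add: True)
    next
      case False
      moreover have "V k \<subseteq> V (Suc k)"
        by (auto simp: V_def intro: le_SucI)
      ultimately show ?thesis
        by (auto simp: indicator_def)
    qed
    have "(\<Sum>i\<le>Suc k. level_sum p q X i (indicator A) / a i)
        \<le> level_sum p q X k (indicator (V k)) / a k
          + level_sum p q X (Suc k) (indicator A) / a (Suc k)"
      using Suc by simp
    also have "\<dots> \<le> level_sum p q X (Suc k) (\<lambda>S. indicator (V k) S + indicator A S) / a (Suc k)"
      using up by (simp add: level_sum_add add_divide_distrib)
    also have "\<dots> \<le> level_sum p q X (Suc k) (indicator (V (Suc k))) / a (Suc k)"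
      using X disj less_imp_le[OF a_pos[OF Suc.prems]]
      by (intro divide_right_mono level_sum_mono) auto
    finally show ?case .
  qed
  from this[of "card X"]
  have "(\<Sum>i\<le>card X. level_sum p q X i (indicator A) / a i)
      \<le> level_sum p q X (card X) (indicator (V (card X))) / a (card X)"
    by simp
  also have "\<dots> \<le> a (card X) / a (card X)"
    unfolding a_def using X less_imp_le[OF level_sum_pos[OF X order_refl]]
    by (intro divide_right_mono level_sum_mono) (auto simp: indicator_def)
  also have "\<dots> = 1"
    using a_pos[of "card X"] by simp
  finally show ?thesis
    by (simp add: a_def)
qed

section \<open>Product distributions\<close>

lemma pmf_product_distribution:
  assumes "product_distribution n P" "S \<subseteq> {1..n}"
  shows "pmf P S = prod_weight (marginal P) (\<lambda>j. 1 - marginal P j) {1..n} S"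
\<comment> \<open>The product rule for independent variables concerns nonempty index sets; without
  coordinates \<open>P\<close> is the point mass at \<open>{}\<close>.\<close>
proof (cases "n = 0")
  case True
  then have "set_pmf P \<subseteq> {{}}" "S = {}"
    using assms by (auto simp: product_distribution_def)
  then have "P = return_pmf {}"
    by (simp add: set_pmf_subset_singleton)
  then show ?thesis
    using True \<open>S = {}\<close> by (simp add: prod_weight_def)
next
  case False
  have indep: "prob_space.indep_vars (measure_pmf P) (\<lambda>_. count_space UNIV) (\<lambda>j z. j \<in> z) {1..n}"
    and supp: "set_pmf P \<subseteq> Pow {1..n}"
    using assms by (auto simp: product_distribution_def)
  define E where "E j = (\<lambda>z. j \<in> z) -` {j \<in> S} \<inter> space (measure_pmf P)" for j
  have "pmf P S = measure_pmf.prob P {S}"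
    by (simp add: measure_pmf_single)
  \<comment> \<open>\<open>E j\<close> says that coordinate \<open>j\<close> agrees with
    \<open>S\<close>. The two events agree only almost surely, since a set in the intersection may
    have elements outside \<open>{1..n}\<close>.\<close>
  also have "\<dots> = measure_pmf.prob P (\<Inter>j\<in>{1..n}. E j)"
    using supp assms(2)
    by (intro measure_pmf.finite_measure_eq_AE) (auto simp: AE_measure_pmf_iff E_def)
  also have "\<dots> = (\<Prod>j\<in>{1..n}. measure_pmf.prob P (E j))"
    unfolding E_def using False
    by (intro prob_space.indep_varsD[OF measure_pmf.prob_space_axioms indep]) auto
  also have "\<dots> = (\<Prod>j\<in>{1..n}. if j \<in> S then marginal P j else 1 - marginal P j)"
  proof (intro prod.cong refl)
    fix j
    have "measure_pmf.prob P (- {z. j \<in> z}) = 1 - marginal P j"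
      by (simp add: marginal_def measure_pmf.prob_compl[of "{z. j \<in> z}", simplified]
          Compl_eq_Diff_UNIV)
    moreover have "E j = (if j \<in> S then {z. j \<in> z} else - {z. j \<in> z})"
      by (auto simp: E_def)
    ultimately show "measure_pmf.prob P (E j) = (if j \<in> S then marginal P j else 1 - marginal P j)"
      by (simp add: marginal_def)
  qed
  also have "\<dots> = prod_weight (marginal P) (\<lambda>j. 1 - marginal P j) {1..n} S"
  proof -
    have "{1..n} \<inter> {j. j \<in> S} = S" "{1..n} \<inter> - {j. j \<in> S} = {1..n} - S"
      using assms(2) by auto
    then show ?thesis
      by (simp add: prod.If_cases prod_weight_def)
  qed
  finally show ?thesis .
qed

text \<open>The bridge from \<open>P\<close> to level sums, used twice: \<open>B = UNIV\<close>
  yields the law of the cardinality, and \<open>B = A\<close> the part of the antichain on each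
  level.\<close>

lemma prob_level_product_distribution:
  assumes "product_distribution n P"
  shows "measure_pmf.prob P {z \<in> B. card z = k} =
    level_sum (marginal P) (\<lambda>j. 1 - marginal P j) {1..n} k (indicator B)"
proof -
  have "measure_pmf.prob P {z \<in> B. card z = k} = measure_pmf.prob P (level {1..n} k \<inter> B)"
    using assms
    by (intro measure_pmf.finite_measure_eq_AE)
      (auto simp: AE_measure_pmf_iff product_distribution_def level_def)
  also have "\<dots> = (\<Sum>S\<in>level {1..n} k \<inter> B. pmf P S)"
    by (intro measure_measure_pmf_finite) (simp add: finite_level)
  also have "\<dots> = (\<Sum>S\<in>level {1..n} k. pmf P S * indicator B S)"
    by (simp add: sum.inter_restrict finite_level indicator_def if_distrib cong: if_cong)
  also have "\<dots> = level_sum (marginal P) (\<lambda>j. 1 - marginal P j) {1..n} k (indicator B)"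
    unfolding level_sum_def
    by (intro sum.cong) (auto simp: level_def pmf_product_distribution[OF assms])
  finally show ?thesis .
qed

section \<open>From the weighted LYM inequality to the bound by the largest level\<close>

theorem theorem1:
  fixes n :: nat and P :: "nat set pmf" and A :: "nat set set"
  assumes "n \<ge> 1"
    and "product_distribution n P"
    and "nontrivial_distribution n P"
    and "antichain_family n A"
  shows "measure_pmf.prob P A \<le> (MAX l\<in>{0..n}. measure_pmf.prob P {z. card z = l})"
proof -
  define W where "W = level_sum (marginal P) (\<lambda>j. 1 - marginal P j) {1..n}"
  define a where "a k = W k (\<lambda>_. 1)" for k
  define M where "M = (MAX l\<in>{0..n}. measure_pmf.prob P {z. card z = l})"
  have pos: "marginal P j > 0" "1 - marginal P j > 0" if "j \<in> {1..n}" for j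
  proof -
    have "marginal P j * (1 - marginal P j) > 0"
      using assms(3) that by (auto simp: nontrivial_distribution_def)
    moreover have "0 \<le> marginal P j" "marginal P j \<le> 1"
      by (auto simp: marginal_def)
    ultimately show "marginal P j > 0" "1 - marginal P j > 0"
      by (auto simp: zero_less_mult_iff)
  qed
  have a_pos: "a k > 0" if "k \<le> n" for k
    unfolding a_def W_def using pos that by (intro level_sum_pos) auto
  have prob: "measure_pmf.prob P {z \<in> B. card z = k} = W k (indicator B)" for B k
    unfolding W_def by (rule prob_level_product_distribution[OF assms(2)])
  have a_le: "a k \<le> M" if "k \<le> n" for k
  proof -
    have "a k = measure_pmf.prob P {z. card z = k}"
      using prob[of UNIV k] by (simp add: a_def)
    then show ?thesis
      unfolding M_def using that by (auto intro!: Max_ge)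
  qed
  have A: "A \<subseteq> Pow {1..n}" "\<And>R S. R \<in> A \<Longrightarrow> S \<in> A \<Longrightarrow> \<not> R \<subset> S"
    using assms(4) by (auto simp: antichain_family_def)
  have "card z \<le> n" if "z \<in> A" for z
    using A(1) that card_mono[of "{1..n}" z] by auto
  then have "(\<Union>k\<in>{..n}. {z \<in> A. card z = k}) = A"
    by auto
  then have "measure_pmf.prob P A = measure_pmf.prob P (\<Union>k\<in>{..n}. {z \<in> A. card z = k})"
    by simp
  also have "\<dots> = (\<Sum>k\<le>n. measure_pmf.prob P {z \<in> A. card z = k})"
    by (intro measure_pmf.finite_measure_finite_Union) (auto simp: disjoint_family_on_def)
  \<comment> \<open>Each level contributes its probability times the conditional probability of
    \<open>A\<close>. Bounding the first factor by \<open>M\<close> leaves exactly the LYM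
    sum.\<close>
  also have "\<dots> = (\<Sum>k\<le>n. a k * (W k (indicator A) / a k))"
    using a_pos by (intro sum.cong) (auto simp: prob less_imp_neq[symmetric])
  also have "\<dots> \<le> (\<Sum>k\<le>n. M * (W k (indicator A) / a k))"
    using a_le a_pos
    by (intro sum_mono mult_right_mono) (auto simp flip: prob simp: less_imp_le)
  also have "\<dots> = M * (\<Sum>k\<le>n. W k (indicator A) / a k)"
    by (simp add: sum_distrib_left)
  also have "\<dots> \<le> M * 1"
  proof (rule mult_left_mono)
    show "(\<Sum>k\<le>n. W k (indicator A) / a k) \<le> 1"
      using weighted_LYM[of "{1..n}" "marginal P" "\<lambda>j. 1 - marginal P j" A] pos A(2)
      by (simp add: W_def a_def)
    show "M \<ge> 0"
      using a_le[of 0] a_pos[of 0] by simp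
  qed
  finally show ?thesis
    by (simp add: M_def)
qed

end
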